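(* Let $p\in\mathcal{H}_{n,d}(e)$, let $u\in\Lambda_+(p,e)$ be such that $B_{p,e}(x)[u]$ is not a matrix sum of squares, and let $\ell(x)$ be a linear form on $\mathbb{R}^n$ such that $\ell(e)>0$ and $\ell(u)=0$. Let $k$ be a nonnegative integer and let $\tilde p(x)=\ell(x)^kp(x)$. Then $\tilde p\in\mathcal{H}_{n,d+k}(e)$, $u\in\Lambda_+(\tilde p,e)$, and $B_{\tilde p,e}(x)[u]$ is not a matrix sum of squares.
   Context: A homogeneous polynomial $p\in\mathbb{R}[x_1,\ldots,x_n]$ of degree $d$ is hyperbolic with respect to $e\in\mathbb{R}^n$ if $p(e)>0$ and for every $x\in\mathbb{R}^n$ the polynomial $t\mapsto p(x+te)$ has only real zeros; $\mathcal{H}_{n,d}(e)$ is the set of such polynomials. The hyperbolicity cone $\Lambda_+(p,e)$ is the set of $x\in\mathbb{R}^n$ such that all zeros of $t\mapsto p(te-x)$ are nonnegative. For $p$ homogeneous of degree $d$ and $x,u\in\mathbb{R}^n$ put $p_x(t)=p(x+te)$ and $D_up_x(t)=(D_up)(x+te)$, with $D_u$ the directional derivative. The parameterized Bézoutian $B_{p,e}(x)[u]$ is the $d\times d$ symmetric matrix (with entries polynomial in $x$) defined by $$\frac{p_x(t)\,D_up_x(s)-D_up_x(t)\,p_x(s)}{t-s}=\sum_{i,j=1}^d [B_{p,e}(x)[u]]_{ij}\,t^{i-1}s^{j-1}.$$ A symmetric matrix $P(x)$ with polynomial entries is a matrix sum of squares if $P(x)=Q(x)Q(x)^T$ for some (possibly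 rectangular) matrix $Q$ with real polynomial entries. *)

theory Defs
  imports "HOL-Analysis.Analysis" "Jordan_Normal_Form.Matrix"
begin

text \<open>
  A real polynomial in the coordinates of \<open>real ^ 'n\<close> is identified with the function it
  induces; over the infinite field of reals this loses nothing.
  Matrices whose size depends on the degree are the \<open>real mat\<close> of \<open>Jordan_Normal_Form\<close>,
  indexed from 0. The infix \<open>$\<close> is reserved for the coordinates of \<open>real ^ 'n\<close>.
\<close>

no_notation vec_index (infixl \<open>$\<close> 100)

text \<open>
  Homogeneous of degree \<open>d\<close>: a real linear combination of the monomials
  \<open>x\<^sup>\<alpha>\<close> with \<open>\<bar>\<alpha>\<bar> = d\<close>. The index set is finite, so the sum is not degenerate.
\<close>

definition exponents :: "nat \<Rightarrow> ('n::finite \<Rightarrow> nat) set" where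
  "exponents d = {\<alpha>. (\<Sum>i\<in>UNIV. \<alpha> i) = d}"

lemma finite_exponents: "finite (exponents d)"
proof (rule finite_subset)
  show "exponents d \<subseteq> (UNIV :: 'a set) \<rightarrow>\<^sub>E {..d}"
  proof
    fix \<alpha> :: "'a \<Rightarrow> nat" assume "\<alpha> \<in> exponents d"
    then have s: "(\<Sum>i\<in>UNIV. \<alpha> i) = d" by (simp add: exponents_def)
    have "\<alpha> i \<le> d" for i
      using member_le_sum[of i UNIV \<alpha>] s by simp
    then show "\<alpha> \<in> UNIV \<rightarrow>\<^sub>E {..d}" by auto
  qed
  show "finite ((UNIV :: 'a set) \<rightarrow>\<^sub>E {..d})" by (intro finite_PiE) auto
qed

definition homogeneous_polynomial :: "nat \<Rightarrow> (real ^ 'n \<Rightarrow> real) \<Rightarrow> bool" where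
  "homogeneous_polynomial d p \<longleftrightarrow>
     (\<exists>c. \<forall>x. p x = (\<Sum>\<alpha>\<in>exponents d. c \<alpha> * (\<Prod>i\<in>UNIV. (x $ i) ^ \<alpha> i)))"

text \<open>All complex zeros of the univariate real polynomial function \<open>f\<close> are real;
  \<open>q\<close> is uniquely determined by \<open>f\<close>.\<close>

definition only_real_zeros :: "(real \<Rightarrow> real) \<Rightarrow> bool" where
  "only_real_zeros f \<longleftrightarrow>
     (\<exists>q :: real poly. (\<forall>t. poly q t = f t) \<and>
        (\<forall>z :: complex. poly (map_poly of_real q) z = 0 \<longrightarrow> z \<in> \<real>))"

definition hyperbolic_polynomials :: "nat \<Rightarrow> real ^ 'n \<Rightarrow> (real ^ 'n \<Rightarrow> real) set" where
  "hyperbolic_polynomials d e =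
     {p. homogeneous_polynomial d p \<and> p e > 0 \<and>
         (\<forall>x. only_real_zeros (\<lambda>t. p (x + t *\<^sub>R e)))}"

text \<open>For hyperbolic \<open>p\<close> every zero of \<open>t \<mapsto> p (t e - x)\<close> is real, so it suffices to
  quantify over real \<open>t\<close>.\<close>

definition hyperbolicity_cone :: "(real ^ 'n \<Rightarrow> real) \<Rightarrow> real ^ 'n \<Rightarrow> (real ^ 'n) set" where
  "hyperbolicity_cone p e = {x. \<forall>t. p (t *\<^sub>R e - x) = 0 \<longrightarrow> t \<ge> 0}"

definition directional_derivative ::
    "real ^ 'n \<Rightarrow> (real ^ 'n \<Rightarrow> real) \<Rightarrow> real ^ 'n \<Rightarrow> real" where
  "directional_derivative u p x = frechet_derivative p (at x) u"

text \<open>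
  \<open>bezoutian d p e u x\<close> is the parameterized Bezoutian \<open>B\<^bsub>p,e\<^esub>(x)[u]\<close> of a
  polynomial \<open>p\<close> that is homogeneous of degree \<open>d\<close>. For such \<open>p\<close>, the numerator
  vanishes on \<open>t = s\<close> and has degree at most \<open>d\<close> in each variable, so the matrix exists;
  it is unique because a polynomial in \<open>(t, s)\<close> that vanishes off the diagonal is zero.
\<close>

definition bezoutian ::
    "nat \<Rightarrow> (real ^ 'n \<Rightarrow> real) \<Rightarrow> real ^ 'n \<Rightarrow> real ^ 'n \<Rightarrow> real ^ 'n \<Rightarrow> real mat" where
  "bezoutian d p e u x =
     (let p\<^sub>x = (\<lambda>t. p (x + t *\<^sub>R e));
          Dp\<^sub>x = (\<lambda>t. directional_derivative u p (x + t *\<^sub>R e))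
      in THE B. B \<in> carrier_mat d d \<and>
           (\<forall>t s. t \<noteq> s \<longrightarrow>
              (p\<^sub>x t * Dp\<^sub>x s - Dp\<^sub>x t * p\<^sub>x s) / (t - s) =
              (\<Sum>i<d. \<Sum>j<d. B $$ (i, j) * t ^ i * s ^ j)))"

text \<open>The size \<open>r \<times> m\<close> of \<open>Q\<close> does not depend on \<open>x\<close>; the equation forces \<open>P x\<close>
  to be \<open>r \<times> r\<close>.\<close>

definition matrix_sos :: "(real ^ 'n \<Rightarrow> real mat) \<Rightarrow> bool" where
  "matrix_sos P \<longleftrightarrow>
     (\<exists>r m Q. (\<forall>x. Q x \<in> carrier_mat r m) \<and>
        (\<forall>i<r. \<forall>j<m. real_polynomial_function (\<lambda>x. Q x $$ (i, j))) \<and>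
        (\<forall>x. P x = Q x * transpose_mat (Q x)))"

end

theory Submission
  imports Defs
begin

text \<open>
  By induction on \<open>k\<close> it suffices to multiply \<open>p\<close> by \<open>L\<close> once. On a line in direction \<open>e\<close> the
  factor is \<open>L x + t * L e\<close>, whose single zero \<open>\<tau> x = - L x / L e\<close> is real, so hyperbolicity is
  preserved; on the line through \<open>- u\<close> this zero is \<open>0\<close>, so \<open>u\<close> stays in the cone.

  Since \<open>L u = 0\<close>, the derivative along \<open>u\<close> treats \<open>L\<close> as a constant, and the Bezoutians, read
  as polynomials in \<open>(t, s)\<close>, satisfy
  \<open>Bez (L * p) (t, s) = (L x + t * L e) * (L x + s * L e) * Bez p (t, s)\<close>
  (lemma \<open>bezoutian_linear_mult\<close>). Suppose that the left-hand side is \<open>Q x * (Q x)\<^sup>T\<close>. Each column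
  of \<open>Q x\<close> is the coefficient vector of a polynomial \<open>q x l\<close> in \<open>t\<close>, and the left-hand side is
  \<open>\<Sum>l. q x l t * q x l s\<close>. At \<open>t = s = \<tau> x\<close> this sum of squares vanishes, hence so does every
  \<open>q x l (\<tau> x)\<close>, and \<open>L x + t * L e\<close> divides \<open>q x l\<close>. The leading coefficient \<open>L e\<close> of the
  divisor is a nonzero constant, so the coefficients of the quotients are again polynomials in
  \<open>x\<close>. They form a matrix \<open>R x\<close>, and cancelling the two linear factors gives
  \<open>Bez p = R x * (R x)\<^sup>T\<close> (lemma \<open>matrix_sos_bezoutian_linear_mult_cancel\<close>).

  To use the defining identity of the Bezoutian its existence and uniqueness are needed; they
  are established in \<open>bezoutian_spec\<close> for every homogeneous polynomial.
\<close>

section \<open>Homogeneous polynomials\<close>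

lemma monomial_times_variable:
  fixes x :: "real ^ 'n" and \<alpha> :: "'n \<Rightarrow> nat"
  shows "(\<Prod>j\<in>UNIV. (x $ j) ^ (\<alpha>(i := Suc (\<alpha> i))) j) = x $ i * (\<Prod>j\<in>UNIV. (x $ j) ^ \<alpha> j)"
  by (simp add: prod.remove[of UNIV i])

lemma exponents_Suc:
  fixes \<alpha> :: "'n::finite \<Rightarrow> nat"
  shows "\<alpha>(i := Suc (\<alpha> i)) \<in> exponents (Suc d) \<longleftrightarrow> \<alpha> \<in> exponents d"
  by (simp add: exponents_def sum.remove[of UNIV i])

lemma homogeneous_polynomial_zero: "homogeneous_polynomial d (\<lambda>x. 0)"
  unfolding homogeneous_polynomial_def by (rule exI[of _ "\<lambda>_. 0"]) simp

lemma homogeneous_polynomial_add: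
  assumes "homogeneous_polynomial d p" "homogeneous_polynomial d q"
  shows "homogeneous_polynomial d (\<lambda>x. p x + q x)"
proof -
  obtain a b where
    "\<forall>x. p x = (\<Sum>\<alpha>\<in>exponents d. a \<alpha> * (\<Prod>i\<in>UNIV. (x $ i) ^ \<alpha> i))"
    "\<forall>x. q x = (\<Sum>\<alpha>\<in>exponents d. b \<alpha> * (\<Prod>i\<in>UNIV. (x $ i) ^ \<alpha> i))"
    using assms unfolding homogeneous_polynomial_def by blast
  then show ?thesis
    unfolding homogeneous_polynomial_def
    by (intro exI[of _ "\<lambda>\<alpha>. a \<alpha> + b \<alpha>"]) (simp add: sum.distrib algebra_simps)
qed

lemma homogeneous_polynomial_scale:
  assumes "homogeneous_polynomial d p"
  shows "homogeneous_polynomial d (\<lambda>x. c * p x)"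
proof -
  obtain a where
    "\<forall>x. p x = (\<Sum>\<alpha>\<in>exponents d. a \<alpha> * (\<Prod>i\<in>UNIV. (x $ i) ^ \<alpha> i))"
    using assms unfolding homogeneous_polynomial_def by blast
  then show ?thesis
    unfolding homogeneous_polynomial_def
    by (intro exI[of _ "\<lambda>\<alpha>. c * a \<alpha>"]) (simp add: sum_distrib_left mult.assoc)
qed

lemma homogeneous_polynomial_sum:
  assumes "finite I" "\<And>i. i \<in> I \<Longrightarrow> homogeneous_polynomial d (p i)"
  shows "homogeneous_polynomial d (\<lambda>x. \<Sum>i\<in>I. p i x)"
  using assms
  by (induction I rule: finite_induct)
     (auto intro: homogeneous_polynomial_zero homogeneous_polynomial_add)

lemma homogeneous_polynomial_monomial:
  assumes "\<beta> \<in> exponents d"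
  shows "homogeneous_polynomial d (\<lambda>x. \<Prod>i\<in>UNIV. (x $ i) ^ \<beta> i)"
  unfolding homogeneous_polynomial_def
proof (intro exI allI)
  fix x :: "real ^ 'a"
  show "(\<Prod>i\<in>UNIV. (x $ i) ^ \<beta> i) =
      (\<Sum>\<alpha>\<in>exponents d. (if \<alpha> = \<beta> then 1 else 0) * (\<Prod>i\<in>UNIV. (x $ i) ^ \<alpha> i))"
    using assms by (simp add: if_distrib[of "\<lambda>c. c * _"] finite_exponents cong: if_cong)
qed

lemma homogeneous_polynomial_variable_mult:
  assumes "homogeneous_polynomial d p"
  shows "homogeneous_polynomial (Suc d) (\<lambda>x. x $ i * p x)"
proof -
  obtain a where a:
    "\<And>x. p x = (\<Sum>\<alpha>\<in>exponents d. a \<alpha> * (\<Prod>i\<in>UNIV. (x $ i) ^ \<alpha> i))"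
    using assms unfolding homogeneous_polynomial_def by blast
  have "x $ i * p x =
      (\<Sum>\<alpha>\<in>exponents d. a \<alpha> * (\<Prod>j\<in>UNIV. (x $ j) ^ (\<alpha>(i := Suc (\<alpha> i))) j))" for x
    unfolding a monomial_times_variable by (simp add: sum_distrib_left algebra_simps)
  then show ?thesis
    by (simp only:)
       (intro homogeneous_polynomial_sum homogeneous_polynomial_scale
          homogeneous_polynomial_monomial finite_exponents, simp only: exponents_Suc)
qed

lemma homogeneous_polynomial_linear_mult:
  fixes L :: "real ^ 'n \<Rightarrow> real"
  assumes L: "linear L" and p: "homogeneous_polynomial d p"
  shows "homogeneous_polynomial (Suc d) (\<lambda>x. L x * p x)"
proof -
  have expand: "L x = (\<Sum>i\<in>UNIV. L (axis i 1) * x $ i)" for x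
  proof -
    have "L x = L (\<Sum>i\<in>UNIV. (x $ i) *\<^sub>R axis i 1)"
      using basis_expansion[of x] by (simp add: scalar_mult_eq_scaleR)
    then show ?thesis
      by (simp add: linear_sum[OF L] linear_scale[OF L] mult.commute)
  qed
  have "L x * p x = (\<Sum>i\<in>UNIV. L (axis i 1) * (x $ i * p x))" for x
    by (subst expand) (simp add: sum_distrib_right mult.assoc)
  then show ?thesis
    by (simp only:)
       (intro homogeneous_polynomial_sum homogeneous_polynomial_scale
          homogeneous_polynomial_variable_mult p finite)
qed

text \<open>Homogeneous polynomials are generated from the constant 1 by multiplication with
  variables and linear combinations of polynomials of equal degree.\<close>

lemma homogeneous_polynomial_induct [consumes 1, case_names one zero variable add scale]:
  fixes p :: "real ^ 'n \<Rightarrow> real"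
  assumes p: "homogeneous_polynomial d p"
    and one: "P 0 (\<lambda>x. 1)"
    and zero: "\<And>d. P d (\<lambda>x. 0)"
    and var: "\<And>d p i. P d p \<Longrightarrow> P (Suc d) (\<lambda>x. x $ i * p x)"
    and add: "\<And>d p q. P d p \<Longrightarrow> P d q \<Longrightarrow> P d (\<lambda>x. p x + q x)"
    and scale: "\<And>d p c. P d p \<Longrightarrow> P d (\<lambda>x. c * p x)"
  shows "P d p"
proof -
  have mono: "P d (\<lambda>x. \<Prod>i\<in>UNIV. (x $ i) ^ \<alpha> i)" if "\<alpha> \<in> exponents d" for d and \<alpha> :: "'n \<Rightarrow> nat"
    using that
  proof (induction d arbitrary: \<alpha>)
    case 0
    then show ?case using one by (simp add: exponents_def)
  next
    case (Suc d)
    then obtain i where "\<alpha> i \<noteq> 0"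
      by (force simp: exponents_def)
    define \<beta> where "\<beta> = \<alpha>(i := \<alpha> i - 1)"
    have \<alpha>: "\<alpha> = \<beta>(i := Suc (\<beta> i))"
      using \<open>\<alpha> i \<noteq> 0\<close> by (auto simp: \<beta>_def)
    then have "\<beta> \<in> exponents d"
      using Suc.prems exponents_Suc by metis
    then have "P (Suc d) (\<lambda>x. x $ i * (\<Prod>i\<in>UNIV. (x $ i) ^ \<beta> i))"
      by (intro var Suc.IH)
    then show ?case
      using monomial_times_variable[of _ \<beta> i] \<alpha> by simp
  qed
  have sum: "P d (\<lambda>x. \<Sum>\<alpha>\<in>A. a \<alpha> * (\<Prod>i\<in>UNIV. (x $ i) ^ \<alpha> i))"
    if "finite A" "A \<subseteq> exponents d" for a and A :: "('n \<Rightarrow> nat) set"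
    using that
  proof (induction A rule: finite_induct)
    case empty
    show ?case using zero by simp
  next
    case (insert \<alpha> A)
    then show ?case by (simp add: add scale mono)
  qed
  obtain a where
    "\<And>x. p x = (\<Sum>\<alpha>\<in>exponents d. a \<alpha> * (\<Prod>i\<in>UNIV. (x $ i) ^ \<alpha> i))"
    using p unfolding homogeneous_polynomial_def by blast
  then have "p = (\<lambda>x. \<Sum>\<alpha>\<in>exponents d. a \<alpha> * (\<Prod>i\<in>UNIV. (x $ i) ^ \<alpha> i))"
    by auto
  then show ?thesis
    using sum[OF finite_exponents] by simp
qed

section \<open>Directional derivatives along a line\<close>

lemma directional_derivative_eq:
  "(p has_derivative D) (at x) \<Longrightarrow> directional_derivative u p x = D u"
  by (simp add: directional_derivative_def frechet_derivative_at[symmetric])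

lemma directional_derivative_mult:
  assumes "p differentiable (at x)" "q differentiable (at x)"
  shows "directional_derivative u (\<lambda>x. p x * q x) x =
    p x * directional_derivative u q x + directional_derivative u p x * q x"
proof -
  obtain D E where D: "(p has_derivative D) (at x)" and E: "(q has_derivative E) (at x)"
    using assms by (auto simp: differentiable_def)
  show ?thesis
    using directional_derivative_eq[OF has_derivative_mult[OF D E], of u]
      directional_derivative_eq[OF D, of u] directional_derivative_eq[OF E, of u]
    by simp
qed

lemma directional_derivative_add:
  assumes "p differentiable (at x)" "q differentiable (at x)"
  shows "directional_derivative u (\<lambda>x. p x + q x) x =
    directional_derivative u p x + directional_derivative u q x"
proof -
  obtain D E where D: "(p has_derivative D) (at x)" and E: "(q has_derivative E) (at x)"
    using assms by (auto simp: differentiable_def)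
  show ?thesis
    using directional_derivative_eq[OF has_derivative_add[OF D E], of u]
      directional_derivative_eq[OF D, of u] directional_derivative_eq[OF E, of u]
    by simp
qed

lemma directional_derivative_const: "directional_derivative u (\<lambda>x. c) x = 0"
  by (rule directional_derivative_eq) simp

lemma directional_derivative_linear:
  fixes L :: "real ^ 'n \<Rightarrow> real"
  assumes "linear L"
  shows "directional_derivative u L x = L u"
  using assms by (intro directional_derivative_eq linear_imp_has_derivative)

text \<open>The sharp bound for the degree of the derivative is \<open>d - 1\<close>; the bound \<open>d\<close> suffices for a
  Bezoutian of size \<open>d\<close> and is also valid for \<open>d = 0\<close>.\<close>

lemma homogeneous_polynomial_on_line:
  fixes p :: "real ^ 'n \<Rightarrow> real"
  assumes "homogeneous_polynomial d p"
  shows "(\<forall>x. p differentiable (at x)) \<and>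
    (\<forall>x. \<exists>f g. degree f \<le> d \<and> degree g \<le> d \<and>
      (\<forall>t. p (x + t *\<^sub>R e) = poly f t) \<and>
      (\<forall>t. directional_derivative u p (x + t *\<^sub>R e) = poly g t))"
  using assms
proof (induction rule: homogeneous_polynomial_induct)
  case one
  show ?case
    by (intro conjI allI exI[of _ "1::real poly"] exI[of _ "0::real poly"])
       (simp_all add: directional_derivative_const)
next
  case (zero d)
  show ?case
    by (auto simp: directional_derivative_const intro!: exI[of _ "0::real poly"])
next
  case (variable d p i)
  have lin: "linear (\<lambda>x :: real ^ 'n. x $ i)"
    by (simp add: linear_iff)
  then have diff: "(\<lambda>x. x $ i) differentiable (at x)" for x :: "real ^ 'n"
    by (rule linear_imp_differentiable)
  show ?case
  proof (intro conjI allI)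
    fix x show "(\<lambda>x. x $ i * p x) differentiable (at x)"
      using diff variable by (intro differentiable_mult) auto
  next
    fix x
    obtain f g where fg: "degree f \<le> d" "degree g \<le> d"
      "\<And>t. p (x + t *\<^sub>R e) = poly f t"
      "\<And>t. directional_derivative u p (x + t *\<^sub>R e) = poly g t"
      using variable by blast
    let ?f = "[:x $ i, e $ i:] * f" and ?g = "[:x $ i, e $ i:] * g + Polynomial.smult (u $ i) f"
    have "degree ([:x $ i, e $ i:] * h) \<le> Suc d" if "degree h \<le> d" for h
      using degree_mult_le[of "[:x $ i, e $ i:]" h] that
      by (auto intro!: order_trans[OF degree_mult_le] simp: le_Suc_eq split: if_splits)
    then have deg: "degree ?f \<le> Suc d" "degree ?g \<le> Suc d"
      using fg(1,2) by (auto intro!: degree_add_le order_trans[OF degree_smult_le])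
    have "directional_derivative u (\<lambda>x. x $ i * p x) (x + t *\<^sub>R e) = poly ?g t" for t
      using directional_derivative_mult[OF diff, of p "x + t *\<^sub>R e" u] variable
        directional_derivative_linear[OF lin, of u]
      by (simp add: fg(3,4) algebra_simps)
    moreover have "(x + t *\<^sub>R e) $ i * p (x + t *\<^sub>R e) = poly ?f t" for t
      by (simp add: fg(3) algebra_simps)
    ultimately show "\<exists>f g. degree f \<le> Suc d \<and> degree g \<le> Suc d \<and>
      (\<forall>t. (x + t *\<^sub>R e) $ i * p (x + t *\<^sub>R e) = poly f t) \<and>
      (\<forall>t. directional_derivative u (\<lambda>x. x $ i * p x) (x + t *\<^sub>R e) = poly g t)"
      using deg by blast
  qed
next
  case (add d p q)
  show ?case
  proof (intro conjI allI)
    fix x show "(\<lambda>x. p x + q x) differentiable (at x)"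
      using add by (intro differentiable_add) auto
  next
    fix x
    obtain f g where fg: "degree f \<le> d" "degree g \<le> d"
      "\<And>t. p (x + t *\<^sub>R e) = poly f t"
      "\<And>t. directional_derivative u p (x + t *\<^sub>R e) = poly g t"
      using add by blast
    obtain f' g' where fg': "degree f' \<le> d" "degree g' \<le> d"
      "\<And>t. q (x + t *\<^sub>R e) = poly f' t"
      "\<And>t. directional_derivative u q (x + t *\<^sub>R e) = poly g' t"
      using add by blast
    show "\<exists>f g. degree f \<le> d \<and> degree g \<le> d \<and>
      (\<forall>t. p (x + t *\<^sub>R e) + q (x + t *\<^sub>R e) = poly f t) \<and>
      (\<forall>t. directional_derivative u (\<lambda>x. p x + q x) (x + t *\<^sub>R e) = poly g t)"
      using add fg fg'
      by (intro exI[of _ "f + f'"] exI[of _ "g + g'"])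
         (auto intro: degree_add_le simp: directional_derivative_add)
  qed
next
  case (scale d p c)
  have d: "directional_derivative u (\<lambda>x. c * p x) x = c * directional_derivative u p x" for x
    using scale directional_derivative_mult[of "\<lambda>_. c" x p u]
    by (simp add: directional_derivative_const)
  show ?case
  proof (intro conjI allI)
    fix x show "(\<lambda>x. c * p x) differentiable (at x)"
      using scale by (intro differentiable_mult) auto
  next
    fix x
    obtain f g where fg: "degree f \<le> d" "degree g \<le> d"
      "\<And>t. p (x + t *\<^sub>R e) = poly f t"
      "\<And>t. directional_derivative u p (x + t *\<^sub>R e) = poly g t"
      using scale by blast
    then show "\<exists>f g. degree f \<le> d \<and> degree g \<le> d \<and>
      (\<forall>t. c * p (x + t *\<^sub>R e) = poly f t) \<and>
      (\<forall>t. directional_derivative u (\<lambda>x. c * p x) (x + t *\<^sub>R e) = poly g t)"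
      by (intro exI[of _ "Polynomial.smult c f"] exI[of _ "Polynomial.smult c g"])
         (auto intro: order_trans[OF degree_smult_le] simp: d)
  qed
qed

section \<open>Existence and uniqueness of the Bezoutian\<close>

lemma polyfun_coeffs_zero:
  fixes a :: "nat \<Rightarrow> real"
  assumes "finite A" and zero: "\<And>t. t \<notin> A \<Longrightarrow> (\<Sum>i<d. a i * t ^ i) = 0" and "i < d"
  shows "a i = 0"
proof -
  obtain n where d: "d = Suc n"
    using \<open>i < d\<close> by (cases d) auto
  have "- A \<subseteq> {t. (\<Sum>i\<le>n. a i * t ^ i) = 0}"
    using zero by (auto simp: d lessThan_Suc_atMost)
  moreover have "infinite (- A)"
    using \<open>finite A\<close> by (metis finite_compl infinite_UNIV_char_0)
  ultimately have "infinite {t. (\<Sum>i\<le>n. a i * t ^ i) = 0}"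
    using finite_subset by blast
  then show ?thesis
    using polyfun_finite_roots[of a n] \<open>i < d\<close> by (auto simp: d)
qed

text \<open>Besides the diagonal, a finite set \<open>A\<close> of values of either variable may be excluded. This
  allows cancellation of a factor that vanishes when \<open>t\<close> or \<open>s\<close> lies in \<open>A\<close>.\<close>

lemma bivariate_coeffs_unique:
  fixes a b :: "nat \<Rightarrow> nat \<Rightarrow> real"
  assumes fin: "finite A"
    and eq: "\<And>t s. t \<notin> A \<Longrightarrow> s \<notin> A \<Longrightarrow> t \<noteq> s \<Longrightarrow>
      (\<Sum>i<d. \<Sum>j<d'. a i j * t ^ i * s ^ j) = (\<Sum>i<d. \<Sum>j<d'. b i j * t ^ i * s ^ j)"
    and ij: "i < d" "j < d'"
  shows "a i j = b i j"
proof -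
  have "(\<Sum>i<d. (a i j - b i j) * t ^ i) = 0" if t: "t \<notin> A" for t
  proof (rule polyfun_coeffs_zero[where A = "insert t A" and d = d' and i = j])
    fix s assume s: "s \<notin> insert t A"
    have "(\<Sum>j<d'. (\<Sum>i<d. (a i j - b i j) * t ^ i) * s ^ j) =
        (\<Sum>i<d. \<Sum>j<d'. (a i j - b i j) * t ^ i * s ^ j)"
      unfolding sum_distrib_right by (rule sum.swap)
    also have "\<dots> = 0"
      using eq[of t s] t s by (simp add: left_diff_distrib sum_subtractf)
    finally show "(\<Sum>j<d'. (\<Sum>i<d. (a i j - b i j) * t ^ i) * s ^ j) = 0" .
  qed (use fin ij in auto)
  from polyfun_coeffs_zero[OF fin this \<open>i < d\<close>] show ?thesis by simp
qed

lemma bezout_quotient_monomials: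
  fixes i j d :: nat
  assumes "i \<le> d" "j \<le> d"
  shows "\<exists>c. \<forall>t s :: real. t ^ i * s ^ j - t ^ j * s ^ i =
    (t - s) * (\<Sum>a<d. \<Sum>b<d. c a b * t ^ a * s ^ b)"
proof -
  have *: "\<exists>c. \<forall>t s :: real. t ^ i * s ^ j - t ^ j * s ^ i =
      (t - s) * (\<Sum>a<d. \<Sum>b<d. c a b * t ^ a * s ^ b)" if "j \<le> i" "i \<le> d" for i j
  proof (intro exI allI)
    fix t s :: real
    \<comment> \<open>For \<open>j \<le> i\<close> the difference is \<open>(t * s) ^ j * (t ^ (i - j) - s ^ (i - j))\<close>, and the
      quotient by \<open>t - s\<close> is the sum of all \<open>t ^ a * s ^ b\<close> with \<open>a + b = i + j - 1\<close> and
      \<open>j \<le> a < i\<close>.\<close>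
    let ?c = "\<lambda>a b. if a \<in> {j..<i} \<and> b = i + j - 1 - a then 1 else 0 :: real"
    have "(\<Sum>b<d. ?c a b * t ^ a * s ^ b) =
        (if a \<in> {j..<i} then t ^ a * s ^ (i + j - 1 - a) else 0)" for a
    proof (cases "a \<in> {j..<i}")
      case True
      then have "i + j - 1 - a < d" using that by auto
      moreover have "(\<Sum>b<d. ?c a b * t ^ a * s ^ b) =
          (\<Sum>b<d. if b = i + j - 1 - a then t ^ a * s ^ b else 0)"
        using True by (intro sum.cong) auto
      ultimately show ?thesis using True by simp
    qed (auto intro!: sum.neutral)
    then have "(\<Sum>a<d. \<Sum>b<d. ?c a b * t ^ a * s ^ b) =
        (\<Sum>a<d. if a \<in> {j..<i} then t ^ a * s ^ (i + j - 1 - a) else 0)"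
      by simp
    also have "\<dots> = (\<Sum>a\<in>{j..<i}. t ^ a * s ^ (i + j - 1 - a))"
      using that by (intro sum.mono_neutral_cong_right) auto
    also have "\<dots> = (\<Sum>l<i - j. t ^ (l + j) * s ^ (i + j - 1 - (l + j)))"
      using that
      by (intro sum.reindex_bij_witness[of _ "\<lambda>l. l + j" "\<lambda>a. a - j"]) auto
    also have "\<dots> = (t * s) ^ j * (\<Sum>l<i - j. s ^ (i - j - Suc l) * t ^ l)"
      unfolding sum_distrib_left
    proof (rule sum.cong)
      fix l assume "l \<in> {..<i - j}"
      then have "i + j - 1 - (l + j) = j + (i - j - Suc l)" by auto
      then show "t ^ (l + j) * s ^ (i + j - 1 - (l + j)) =
          (t * s) ^ j * (s ^ (i - j - Suc l) * t ^ l)"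
        by (simp only: power_add power_mult_distrib) simp
    qed simp
    finally have "(t - s) * (\<Sum>a<d. \<Sum>b<d. ?c a b * t ^ a * s ^ b) =
        (t * s) ^ j * (t ^ (i - j) - s ^ (i - j))"
      by (simp add: power_diff_sumr2)
    also have "\<dots> = t ^ (j + (i - j)) * s ^ j - t ^ j * s ^ (j + (i - j))"
      by (simp only: power_add power_mult_distrib) (simp add: algebra_simps)
    finally show "t ^ i * s ^ j - t ^ j * s ^ i =
        (t - s) * (\<Sum>a<d. \<Sum>b<d. ?c a b * t ^ a * s ^ b)"
      using that by simp
  qed
  show ?thesis
  proof (cases "j \<le> i")
    case True
    then show ?thesis using * assms by blast
  next
    case False
    then obtain c where c: "\<And>t s :: real. t ^ j * s ^ i - t ^ i * s ^ j =
        (t - s) * (\<Sum>a<d. \<Sum>b<d. c a b * t ^ a * s ^ b)"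
      using *[of i j] assms by auto
    have "t ^ i * s ^ j - t ^ j * s ^ i =
        (t - s) * (\<Sum>a<d. \<Sum>b<d. - c a b * t ^ a * s ^ b)" for t s :: real
      using c[of t s] by (simp add: sum_negf)
    then show ?thesis by (intro exI[of _ "\<lambda>a b. - c a b"]) blast
  qed
qed

lemma bezout_quotient_exists:
  fixes f g :: "real poly"
  assumes f: "degree f \<le> d" and g: "degree g \<le> d"
  shows "\<exists>c. \<forall>t s. poly f t * poly g s - poly g t * poly f s =
    (t - s) * (\<Sum>a<d. \<Sum>b<d. c a b * t ^ a * s ^ b)"
proof -
  \<comment> \<open>The functions that are \<open>t - s\<close> times a polynomial of degree below \<open>d\<close> in each variable
    form a linear space, so the claim reduces to monomials.\<close>
  define rep :: "(real \<Rightarrow> real \<Rightarrow> real) \<Rightarrow> bool" where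
    "rep F \<longleftrightarrow> (\<exists>c. \<forall>t s. F t s = (t - s) * (\<Sum>a<d. \<Sum>b<d. c a b * t ^ a * s ^ b))" for F
  have zero: "rep (\<lambda>t s. 0)"
    unfolding rep_def by (rule exI[of _ "\<lambda>_ _. 0"]) simp
  have add: "rep (\<lambda>t s. F t s + G t s)" if FG: "rep F" "rep G" for F G
  proof -
    obtain c c' where
      "\<forall>t s. F t s = (t - s) * (\<Sum>a<d. \<Sum>b<d. c a b * t ^ a * s ^ b)"
      "\<forall>t s. G t s = (t - s) * (\<Sum>a<d. \<Sum>b<d. c' a b * t ^ a * s ^ b)"
      using FG unfolding rep_def by blast
    then show ?thesis
      unfolding rep_def
      by (intro exI[of _ "\<lambda>a b. c a b + c' a b"])
         (simp add: distrib_right distrib_left sum.distrib)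
  qed
  have scale: "rep (\<lambda>t s. k * F t s)" if F: "rep F" for F k
  proof -
    obtain c where
      "\<forall>t s. F t s = (t - s) * (\<Sum>a<d. \<Sum>b<d. c a b * t ^ a * s ^ b)"
      using F unfolding rep_def by blast
    then show ?thesis
      unfolding rep_def
      by (intro exI[of _ "\<lambda>a b. k * c a b"]) (simp add: sum_distrib_left mult_ac)
  qed
  have sum: "rep (\<lambda>t s. \<Sum>i\<in>I. F i t s)" if "finite I" "\<And>i. i \<in> I \<Longrightarrow> rep (F i)"
    for I :: "nat set" and F
    using that by (induction I rule: finite_induct) (auto intro: zero add)
  have expand: "poly h t = (\<Sum>i\<le>d. coeff h i * t ^ i)" if "degree h \<le> d" for h :: "real poly" and t
    unfolding poly_altdef using that
    by (intro sum.mono_neutral_left) (auto simp: coeff_eq_0)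
  have "poly f t * poly g s - poly g t * poly f s =
      (\<Sum>i\<le>d. \<Sum>j\<le>d. coeff f i * coeff g j * (t ^ i * s ^ j - t ^ j * s ^ i))" for t s
  proof -
    have "poly f t * poly g s = (\<Sum>i\<le>d. \<Sum>j\<le>d. coeff f i * coeff g j * (t ^ i * s ^ j))"
      unfolding expand[OF f] expand[OF g] sum_product by (simp add: mult_ac)
    moreover have "poly g t * poly f s = (\<Sum>i\<le>d. \<Sum>j\<le>d. coeff f i * coeff g j * (t ^ j * s ^ i))"
      unfolding expand[OF f] expand[OF g] mult.commute[of _ "\<Sum>i\<le>d. coeff f i * s ^ i"]
        sum_product by (simp add: mult_ac)
    ultimately show ?thesis
      by (simp add: right_diff_distrib sum_subtractf)
  qed
  moreover have "rep (\<lambda>t s. \<Sum>i\<le>d. \<Sum>j\<le>d. coeff f i * coeff g j * (t ^ i * s ^ j - t ^ j * s ^ i))"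
    by (intro sum scale finite_atMost) (simp add: rep_def bezout_quotient_monomials)
  ultimately show ?thesis
    by (simp add: rep_def)
qed

lemma bezoutian_spec:
  fixes p :: "real ^ 'n \<Rightarrow> real"
  assumes p: "homogeneous_polynomial d p"
  shows bezoutian_carrier: "bezoutian d p e u x \<in> carrier_mat d d"
    and bezoutian_eq: "t \<noteq> s \<Longrightarrow>
      p (x + t *\<^sub>R e) * directional_derivative u p (x + s *\<^sub>R e)
        - directional_derivative u p (x + t *\<^sub>R e) * p (x + s *\<^sub>R e) =
      (t - s) * (\<Sum>i<d. \<Sum>j<d. bezoutian d p e u x $$ (i, j) * t ^ i * s ^ j)"
proof -
  let ?F = "\<lambda>t s. p (x + t *\<^sub>R e) * directional_derivative u p (x + s *\<^sub>R e)
        - directional_derivative u p (x + t *\<^sub>R e) * p (x + s *\<^sub>R e)"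
  let ?spec = "\<lambda>B. B \<in> carrier_mat d d \<and> (\<forall>t s. t \<noteq> s \<longrightarrow>
      ?F t s / (t - s) = (\<Sum>i<d. \<Sum>j<d. B $$ (i, j) * t ^ i * s ^ j))"
  obtain f g where fg: "degree f \<le> d" "degree g \<le> d"
    "\<And>t. p (x + t *\<^sub>R e) = poly f t"
    "\<And>t. directional_derivative u p (x + t *\<^sub>R e) = poly g t"
    using homogeneous_polynomial_on_line[OF p, of e u] by blast
  obtain c where c: "\<And>t s. ?F t s = (t - s) * (\<Sum>a<d. \<Sum>b<d. c a b * t ^ a * s ^ b)"
    using bezout_quotient_exists[OF fg(1,2)] unfolding fg(3,4) by blast
  have "\<exists>!B. ?spec B"
  proof (rule ex1I)
    show "?spec (mat d d (\<lambda>(i, j). c i j))"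
      unfolding c by simp
  next
    fix B assume B: "?spec B"
    show "B = mat d d (\<lambda>(i, j). c i j)"
    proof (rule eq_matI)
      fix i j assume ij: "i < dim_row (mat d d (\<lambda>(i, j). c i j))" "j < dim_col (mat d d (\<lambda>(i, j). c i j))"
      have "B $$ (i, j) = c i j"
      proof (rule bivariate_coeffs_unique[where A = "{}" and d = d and d' = d])
        fix t s :: real assume "t \<noteq> s"
        then have "?F t s / (t - s) = (\<Sum>i<d. \<Sum>j<d. B $$ (i, j) * t ^ i * s ^ j)"
          using B by blast
        moreover have "?F t s / (t - s) = (\<Sum>i<d. \<Sum>j<d. c i j * t ^ i * s ^ j)"
          unfolding c using \<open>t \<noteq> s\<close> by simp
        ultimately show "(\<Sum>i<d. \<Sum>j<d. B $$ (i, j) * t ^ i * s ^ j) =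
            (\<Sum>i<d. \<Sum>j<d. c i j * t ^ i * s ^ j)" by simp
      qed (use ij in auto)
      then show "B $$ (i, j) = mat d d (\<lambda>(i, j). c i j) $$ (i, j)" using ij by simp
    qed (use B in auto)
  qed
  then have spec: "?spec (bezoutian d p e u x)"
    unfolding bezoutian_def Let_def by (rule theI')
  then show "bezoutian d p e u x \<in> carrier_mat d d" by blast
  assume "t \<noteq> s"
  then have "?F t s / (t - s) = (\<Sum>i<d. \<Sum>j<d. bezoutian d p e u x $$ (i, j) * t ^ i * s ^ j)"
    using spec by blast
  then show "?F t s = (t - s) * (\<Sum>i<d. \<Sum>j<d. bezoutian d p e u x $$ (i, j) * t ^ i * s ^ j)"
    using \<open>t \<noteq> s\<close> by (simp add: divide_eq_eq mult.commute)
qed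

section \<open>Multiplication by one linear form\<close>

lemma only_real_zeros_linear_mult:
  assumes f: "only_real_zeros f" and b: "b \<noteq> 0"
  shows "only_real_zeros (\<lambda>t. (a + t * b) * f t)"
proof -
  obtain q :: "real poly" where q: "\<And>t. poly q t = f t"
    and real: "\<And>z :: complex. poly (map_poly of_real q) z = 0 \<Longrightarrow> z \<in> \<real>"
    using f unfolding only_real_zeros_def by blast
  have "map_poly complex_of_real ([:a, b:] * q) =
      map_poly of_real [:a, b:] * map_poly of_real q"
    by (rule poly_eqI) (simp add: coeff_map_poly coeff_mult del: mult_pCons_left)
  then have map: "poly (map_poly of_real ([:a, b:] * q)) z =
      (of_real a + z * of_real b) * poly (map_poly of_real q) z" for z :: complex
    by (simp only: poly_mult) (simp add: map_poly_pCons)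
  have "z \<in> \<real>" if "of_real a + z * of_real b = 0" for z :: complex
  proof -
    have "z = of_real (- a / b)"
      using that b by (simp add: field_simps add_eq_0_iff)
    then show ?thesis by simp
  qed
  then have "z \<in> \<real>" if "poly (map_poly of_real ([:a, b:] * q)) z = 0" for z :: complex
    using that real[of z] unfolding map by auto
  moreover have "poly ([:a, b:] * q) t = (a + t * b) * f t" for t
    by (simp add: q distrib_right mult.assoc)
  ultimately show ?thesis
    unfolding only_real_zeros_def by blast
qed

lemma hyperbolic_linear_mult:
  assumes p: "p \<in> hyperbolic_polynomials d e" and L: "linear L" "L e > 0"
  shows "(\<lambda>x. L x * p x) \<in> hyperbolic_polynomials (Suc d) e"
proof -
  have "only_real_zeros (\<lambda>t. L (x + t *\<^sub>R e) * p (x + t *\<^sub>R e))" for x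
    using only_real_zeros_linear_mult[of "\<lambda>t. p (x + t *\<^sub>R e)" "L e" "L x"] p L
    by (simp add: hyperbolic_polynomials_def linear_add linear_scale)
  then show ?thesis
    using p L homogeneous_polynomial_linear_mult[OF L(1), of d p]
    by (simp add: hyperbolic_polynomials_def)
qed

lemma hyperbolicity_cone_linear_mult:
  assumes "u \<in> hyperbolicity_cone p e" and "linear L" "L e > 0" "L u = 0"
  shows "u \<in> hyperbolicity_cone (\<lambda>x. L x * p x) e"
  using assms by (auto simp: hyperbolicity_cone_def linear_diff linear_scale)

lemma bezoutian_linear_mult:
  fixes p L :: "real ^ 'n \<Rightarrow> real"
  assumes p: "homogeneous_polynomial d p" and L: "linear L" "L u = 0" and ts: "t \<noteq> s"
  shows "(\<Sum>i<Suc d. \<Sum>j<Suc d. bezoutian (Suc d) (\<lambda>x. L x * p x) e u x $$ (i, j) * t ^ i * s ^ j) =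
    (L x + t * L e) * (L x + s * L e) *
      (\<Sum>i<d. \<Sum>j<d. bezoutian d p e u x $$ (i, j) * t ^ i * s ^ j)"
    (is "?S = _ * ?T")
proof -
  have D: "directional_derivative u (\<lambda>x. L x * p x) y = L y * directional_derivative u p y" for y
    using directional_derivative_mult[of L y p u] L homogeneous_polynomial_on_line[OF p]
    by (simp add: directional_derivative_linear linear_imp_differentiable)
  have l: "L (x + t *\<^sub>R e) = L x + t * L e" for t
    using L by (simp add: linear_add linear_scale)
  have "(t - s) * ?S =
      (L x + t * L e) * p (x + t *\<^sub>R e)
          * ((L x + s * L e) * directional_derivative u p (x + s *\<^sub>R e))
        - (L x + t * L e) * directional_derivative u p (x + t *\<^sub>R e)
          * ((L x + s * L e) * p (x + s *\<^sub>R e))"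
    using bezoutian_eq[OF homogeneous_polynomial_linear_mult[OF L(1) p] ts, of x e u]
    unfolding D l by (rule sym)
  also have "\<dots> = (L x + t * L e) * (L x + s * L e) *
      (p (x + t *\<^sub>R e) * directional_derivative u p (x + s *\<^sub>R e)
        - directional_derivative u p (x + t *\<^sub>R e) * p (x + s *\<^sub>R e))"
    by (simp only: right_diff_distrib mult_ac)
  also have "\<dots> = (L x + t * L e) * (L x + s * L e) * ((t - s) * ?T)"
    unfolding bezoutian_eq[OF p ts, of x e u] ..
  finally have "(t - s) * ?S = (t - s) * ((L x + t * L e) * (L x + s * L e) * ?T)"
    by (simp only: mult_ac)
  then show ?thesis using ts by simp
qed

section \<open>Dividing a sum of squares by the linear form\<close>

text \<open>Read as a polynomial in \<open>(t, s)\<close>, \<open>Q * Q\<^sup>T\<close> is the sum, over the columns of \<open>Q\<close>, of the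
  column polynomial at \<open>t\<close> times the column polynomial at \<open>s\<close>.\<close>

lemma gram_sum:
  fixes Q :: "real mat"
  assumes "Q \<in> carrier_mat r m"
  shows "(\<Sum>i<r. \<Sum>j<r. (Q * transpose_mat Q) $$ (i, j) * t ^ i * s ^ j) =
    (\<Sum>l<m. (\<Sum>i<r. Q $$ (i, l) * t ^ i) * (\<Sum>j<r. Q $$ (j, l) * s ^ j))"
proof -
  have "(\<Sum>l<m. (\<Sum>i<r. Q $$ (i, l) * t ^ i) * (\<Sum>j<r. Q $$ (j, l) * s ^ j)) =
      (\<Sum>l<m. \<Sum>i<r. \<Sum>j<r. Q $$ (i, l) * Q $$ (j, l) * t ^ i * s ^ j)"
    unfolding sum_product by (simp add: mult_ac)
  also have "\<dots> = (\<Sum>i<r. \<Sum>l<m. \<Sum>j<r. Q $$ (i, l) * Q $$ (j, l) * t ^ i * s ^ j)"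
    by (rule sum.swap)
  also have "\<dots> = (\<Sum>i<r. \<Sum>j<r. \<Sum>l<m. Q $$ (i, l) * Q $$ (j, l) * t ^ i * s ^ j)"
    by (intro sum.cong sum.swap refl)
  also have "\<dots> = (\<Sum>i<r. \<Sum>j<r. (Q * transpose_mat Q) $$ (i, j) * t ^ i * s ^ j)"
    using assms
    by (intro sum.cong refl) (simp add: scalar_prod_def sum_distrib_right lessThan_atLeast0)
  finally show ?thesis by simp
qed

lemma matrix_sos_bezoutian_linear_mult_cancel:
  fixes p L :: "real ^ 'n \<Rightarrow> real"
  assumes p: "homogeneous_polynomial d p" and L: "linear L" "L e > 0" "L u = 0"
    and sos: "matrix_sos (bezoutian (Suc d) (\<lambda>x. L x * p x) e u)"
  shows "matrix_sos (bezoutian d p e u)"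
proof -
  let ?B' = "bezoutian (Suc d) (\<lambda>x. L x * p x) e u" and ?B = "bezoutian d p e u"
  obtain r m Q where Q_r: "\<And>x. Q x \<in> carrier_mat r m"
    and Q_poly': "\<And>i l. i < r \<Longrightarrow> l < m \<Longrightarrow> real_polynomial_function (\<lambda>x. Q x $$ (i, l))"
    and BQ: "\<And>x. ?B' x = Q x * transpose_mat (Q x)"
    using sos unfolding matrix_sos_def by blast
  have "r = Suc d"
    using bezoutian_carrier[OF homogeneous_polynomial_linear_mult[OF L(1) p], of e u 0]
      Q_r[of 0] BQ[of 0] by (metis carrier_matD(1) index_mult_mat(2))
  with Q_r Q_poly' have Q: "\<And>x. Q x \<in> carrier_mat (Suc d) m"
    and Q_poly: "\<And>i l. i \<le> d \<Longrightarrow> l < m \<Longrightarrow> real_polynomial_function (\<lambda>x. Q x $$ (i, l))"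
    by auto
  define \<tau> where "\<tau> x = - L x / L e" for x
  have fac: "L x + t * L e = L e * (t - \<tau> x)" for x t
    using L(2) by (simp add: \<tau>_def field_simps)
  define q where "q x l t = (\<Sum>i\<le>d. Q x $$ (i, l) * t ^ i)" for x l t
  have gram_Q: "(\<Sum>i<Suc d. \<Sum>j<Suc d. ?B' x $$ (i, j) * t ^ i * s ^ j) =
      (\<Sum>l<m. q x l t * q x l s)" for x t s
    unfolding BQ gram_sum[OF Q] unfolding q_def lessThan_Suc_atMost ..

  \<comment> \<open>The identity for the Bezoutian holds only for \<open>t \<noteq> s\<close>. At \<open>t = \<tau> x\<close> it gives a polynomial in
    \<open>s\<close> that vanishes for \<open>s \<noteq> \<tau> x\<close>, hence has zero coefficients, and so vanishes at
    \<open>s = \<tau> x\<close> too.\<close>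
  have vanish: "q x l (\<tau> x) = 0" if "l < m" for x l
  proof -
    have "(\<Sum>i<Suc d. ?B' x $$ (i, j) * \<tau> x ^ i) = 0" if j: "j < Suc d" for j
    proof (rule polyfun_coeffs_zero[where A = "{\<tau> x}" and d = "Suc d" and i = j])
      fix s assume "s \<notin> {\<tau> x}"
      then have "(\<Sum>i<Suc d. \<Sum>j<Suc d. ?B' x $$ (i, j) * \<tau> x ^ i * s ^ j) = 0"
        by (subst bezoutian_linear_mult[OF p L(1,3)]) (auto simp: fac)
      then show "(\<Sum>j<Suc d. (\<Sum>i<Suc d. ?B' x $$ (i, j) * \<tau> x ^ i) * s ^ j) = 0"
        unfolding sum_distrib_right by (subst sum.swap)
    qed (use j in auto)
    then have "(\<Sum>j<Suc d. (\<Sum>i<Suc d. ?B' x $$ (i, j) * \<tau> x ^ i) * \<tau> x ^ j) = 0"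
      by (intro sum.neutral) simp
    then have "(\<Sum>l<m. q x l (\<tau> x) * q x l (\<tau> x)) = 0"
      unfolding gram_Q[symmetric] sum_distrib_right by (subst sum.swap)
    then show ?thesis
      using \<open>l < m\<close> by (subst (asm) sum_nonneg_eq_0_iff) auto
  qed

  \<comment> \<open>The column polynomials of \<open>R x\<close> are the quotients of \<open>q x l\<close> by \<open>L x + t * L e\<close>, with
    coefficients as in \<open>polyfun_diff\<close>. Only the constant \<open>L e\<close> is divided by.\<close>
  define R where "R x = mat d m (\<lambda>(j, l).
    (\<Sum>i = Suc j..d. Q x $$ (i, l) * \<tau> x ^ (i - j - 1)) / L e)" for x
  have R: "R x \<in> carrier_mat d m" for x
    by (simp add: R_def)
  have quot: "q x l t = (L x + t * L e) * (\<Sum>j<d. R x $$ (j, l) * t ^ j)" if "l < m" for x l t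
  proof (cases "d = 0")
    case True
    then show ?thesis using vanish[OF that, of x] by (simp add: q_def)
  next
    case False
    have "q x l t = q x l t - q x l (\<tau> x)"
      by (simp add: vanish[OF that])
    also have "\<dots> = (t - \<tau> x) *
        (\<Sum>j<d. (\<Sum>i = Suc j..d. Q x $$ (i, l) * \<tau> x ^ (i - j - 1)) * t ^ j)"
      unfolding q_def using False by (intro polyfun_diff) simp
    also have "\<dots> = (t - \<tau> x) * (\<Sum>j<d. (L e * R x $$ (j, l)) * t ^ j)"
      using L(2) that by (simp add: R_def)
    also have "\<dots> = (L x + t * L e) * (\<Sum>j<d. R x $$ (j, l) * t ^ j)"
      unfolding fac by (simp add: sum_distrib_left mult_ac)
    finally show ?thesis .
  qed

  have "?B x = R x * transpose_mat (R x)" for x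
  proof (rule eq_matI)
    fix i j assume "i < dim_row (R x * transpose_mat (R x))" "j < dim_col (R x * transpose_mat (R x))"
    then have ij: "i < d" "j < d"
      using R[of x] by auto
    show "?B x $$ (i, j) = (R x * transpose_mat (R x)) $$ (i, j)"
    proof (rule bivariate_coeffs_unique[where A = "{\<tau> x}" and d = d and d' = d])
      fix t s assume ts: "t \<notin> {\<tau> x}" "s \<notin> {\<tau> x}" "t \<noteq> s"
      let ?c = "(L x + t * L e) * (L x + s * L e)"
      have "?c * (\<Sum>i<d. \<Sum>j<d. ?B x $$ (i, j) * t ^ i * s ^ j) = (\<Sum>l<m. q x l t * q x l s)"
        using bezoutian_linear_mult[OF p L(1,3) ts(3), of e x] gram_Q[of x t s] by simp
      also have "\<dots> = ?c * (\<Sum>l<m. (\<Sum>i<d. R x $$ (i, l) * t ^ i) * (\<Sum>j<d. R x $$ (j, l) * s ^ j))"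
        unfolding sum_distrib_left[where r = ?c]
        by (intro sum.cong refl) (simp add: quot mult_ac)
      also have "\<dots> = ?c * (\<Sum>i<d. \<Sum>j<d. (R x * transpose_mat (R x)) $$ (i, j) * t ^ i * s ^ j)"
        by (simp only: gram_sum[OF R])
      finally show "(\<Sum>i<d. \<Sum>j<d. ?B x $$ (i, j) * t ^ i * s ^ j) =
          (\<Sum>i<d. \<Sum>j<d. (R x * transpose_mat (R x)) $$ (i, j) * t ^ i * s ^ j)"
        using ts(1,2) L(2) by (simp add: fac)
    qed (use ij in auto)
  qed (use R[of x] bezoutian_carrier[OF p, of e u x] in auto)
  moreover have "real_polynomial_function (\<lambda>x. R x $$ (j, l))" if "j < d" "l < m" for j l
  proof -
    have "bounded_linear (\<lambda>x. (- 1 / L e) * L x)"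
      using L(1) by (intro bounded_linear_const_mult) (simp add: linear_conv_bounded_linear)
    then have "bounded_linear \<tau>"
      by (simp add: \<tau>_def[abs_def])
    then have "real_polynomial_function \<tau>"
      by (rule real_polynomial_function.intros(1))
    then have "real_polynomial_function (\<lambda>x.
        (\<Sum>i = Suc j..d. Q x $$ (i, l) * \<tau> x ^ (i - j - 1)) / L e)"
      using that
      by (intro real_polynomial_function_divide real_polynomial_function_sum
          real_polynomial_function.intros(4) real_polynomial_function_power Q_poly) auto
    then show ?thesis using that by (simp add: R_def)
  qed
  ultimately show ?thesis
    unfolding matrix_sos_def using R by blast
qed

section \<open>Powers of a linear form\<close>

theorem proposition4p10:
  fixes p L :: "real ^ 'n \<Rightarrow> real" and e u :: "real ^ 'n" and d k :: nat
  assumes "p \<in> hyperbolic_polynomials d e"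
    and "u \<in> hyperbolicity_cone p e"
    and "\<not> matrix_sos (bezoutian d p e u)"
    and "linear L" and "L e > 0" and "L u = 0"
  shows "(\<lambda>x. L x ^ k * p x) \<in> hyperbolic_polynomials (d + k) e
    \<and> u \<in> hyperbolicity_cone (\<lambda>x. L x ^ k * p x) e
    \<and> \<not> matrix_sos (bezoutian (d + k) (\<lambda>x. L x ^ k * p x) e u)"
proof (induction k)
  case 0
  then show ?case using assms by simp
next
  case (Suc k)
  let ?p = "\<lambda>x. L x ^ k * p x"
  have *: "(\<lambda>x. L x ^ Suc k * p x) = (\<lambda>x. L x * ?p x)"
    by (simp add: mult.assoc)
  have "homogeneous_polynomial (d + k) ?p"
    using Suc.IH by (simp add: hyperbolic_polynomials_def)
  then have "\<not> matrix_sos (bezoutian (Suc (d + k)) (\<lambda>x. L x * ?p x) e u)"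
    using matrix_sos_bezoutian_linear_mult_cancel[of "d + k" ?p L e u] Suc.IH assms(4-6)
    by blast
  then show ?case
    unfolding * add_Suc_right
    using Suc.IH assms(4-6) hyperbolic_linear_mult[of ?p "d + k" e L]
      hyperbolicity_cone_linear_mult[of u ?p e L]
    by blast
qed

end
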